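(* Let $a,b\ge 1$ be integers with $a+2b>3$, let $G=K_{a,b,b}$ be the complete tripartite graph with part sizes $a,b,b$, and let $\phi(x,y)=\frac{xy}{x+y}$. Then the inverse sum indeg matrix $ISI(G)$ has exactly three distinct eigenvalues if and only if $a=b$ or $a=9b$. In particular, for every integer $b\ge 1$, the irregular graph $K_{9b,b,b}$ satisfies $$\operatorname{Spec}(ISI(K_{9b,b,b}))=\{0^{[11b-3]},\,10b^2,\,(-5b^2)^{[2]}\}.$$
   Context: For a finite simple graph $G$ with vertices $v_1,\dots,v_n$ of degrees $d_1,\dots,d_n$, $ISI(G)$ is the $n\times n$ real symmetric matrix whose $(i,j)$ entry is $\frac{d_id_j}{d_i+d_j}$ if $v_i$ and $v_j$ are adjacent, and $0$ otherwise. $\operatorname{Spec}(M)$ is the multiset of eigenvalues of $M$; $\lambda^{[k]}$ means $\lambda$ repeated with multiplicity $k$. *)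

theory Defs
  imports "Jordan_Normal_Form.Spectral_Radius" "Graph_Theory.Digraph"
begin

text \<open>
  A finite simple graph is a symmetric, loop-free digraph without multiple arcs (locale
  \<^locale>\<open>graph\<close>); an edge is a pair of opposite arcs, so the degree of a vertex is its
  out-degree.
\<close>

definition regular_graph :: "('v, 'e) pre_digraph \<Rightarrow> bool" where
  "regular_graph G \<longleftrightarrow> (\<exists>k. \<forall>v \<in> verts G. out_degree G v = k)"

definition complete_tripartite_graph :: "nat \<Rightarrow> nat \<Rightarrow> nat \<Rightarrow> ('v, 'e) pre_digraph \<Rightarrow> bool" where
  "complete_tripartite_graph a b c G \<longleftrightarrow> graph G \<and>
     (\<exists>U V W. verts G = U \<union> V \<union> W \<and> U \<inter> V = {} \<and> U \<inter> W = {} \<and> V \<inter> W = {} \<and>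
        card U = a \<and> card V = b \<and> card W = c \<and>
        arcs_ends G = U \<times> V \<union> V \<times> U \<union> U \<times> W \<union> W \<times> U \<union> V \<times> W \<union> W \<times> V)"

lemma complete_tripartite_graph_exists:
  "\<exists>G :: (nat, nat \<times> nat) pre_digraph. complete_tripartite_graph a b c G"
proof -
  define U where "U = {0..<a}"
  define V where "V = {a..<a + b}"
  define W where "W = {a + b..<a + b + c}"
  define E where "E = U \<times> V \<union> V \<times> U \<union> U \<times> W \<union> W \<times> U \<union> V \<times> W \<union> W \<times> V"
  define G :: "(nat, nat \<times> nat) pre_digraph" where
    "G = \<lparr>verts = U \<union> V \<union> W, arcs = E, tail = fst, head = snd\<rparr>"
  have fin: "finite U" "finite V" "finite W" "finite E"
    by (auto simp: U_def V_def W_def E_def)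
  have disj: "U \<inter> V = {}" "U \<inter> W = {}" "V \<inter> W = {}"
    by (auto simp: U_def V_def W_def)
  have ends: "arcs_ends G = E"
    by (simp add: G_def arcs_ends_conv)
  have "sym E"
    by (auto simp: E_def sym_def)
  then have "graph G"
    using fin disj ends
    by unfold_locales (auto simp: G_def arc_to_ends_def symmetric_def E_def)
  then show ?thesis
    unfolding complete_tripartite_graph_def
    using disj ends
    by (intro exI[of _ G] conjI exI[of _ U] exI[of _ V] exI[of _ W])
       (simp_all add: G_def E_def U_def V_def W_def)
qed

text \<open>The list \<open>vs\<close> is an enumeration \<open>v\<^sub>1, \<dots>, v\<^sub>n\<close> of the vertices, without repetition.\<close>

definition vertex_enum :: "('v, 'e) pre_digraph \<Rightarrow> 'v list \<Rightarrow> bool" where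
  "vertex_enum G vs \<longleftrightarrow> distinct vs \<and> set vs = verts G"

definition isi_weight :: "real \<Rightarrow> real \<Rightarrow> real" where
  "isi_weight x y = x * y / (x + y)"

definition ISI :: "('v, 'e) pre_digraph \<Rightarrow> 'v list \<Rightarrow> real mat" where
  "ISI G vs = mat (length vs) (length vs) (\<lambda>(i, j).
     if (vs ! i, vs ! j) \<in> arcs_ends G
     then isi_weight (real (out_degree G (vs ! i))) (real (out_degree G (vs ! j)))
     else 0)"

text \<open>
  Eigenvalues with algebraic multiplicity. Only roots in the base field are counted; a real symmetric
  matrix such as \<open>ISI G vs\<close> has no others.
\<close>

definition Spec :: "real mat \<Rightarrow> real multiset" where
  "Spec M = proots (char_poly M)"

end

theory Submission
  imports Defs
begin

text \<open>
  The entry of \<open>ISI(K\<^bsub>a,b,b\<^esub>)\<close> at two vertices depends only on the parts containing them, so the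
  matrix has rank at most 3 and is a product \<open>P * C\<close> through a 3-dimensional space, with \<open>P\<close> the
  vertex-part incidence matrix. The products \<open>P * C\<close> and \<open>C * P\<close> have the same characteristic
  polynomial up to powers of \<open>x\<close> (\<open>char_poly_mult_swap\<close>), and \<open>C * P\<close> is the 3 by 3 quotient matrix
  with rows \<open>(0, b p, b p)\<close>, \<open>(a p, 0, b q)\<close>, \<open>(a p, b q, 0)\<close>. Here \<open>p = \<phi>(2b, a+b)\<close> is the weight of
  the edges at the part of size \<open>a\<close>, and \<open>q = \<phi>(a+b, a+b) = (a+b)/2\<close> the weight of the others.

  Exchanging the two parts of size \<open>b\<close> is a symmetry, and the antisymmetric vector \<open>(0, 1, -1)\<close>
  splits off the eigenvalue \<open>-s\<close> with \<open>s = b q\<close>. The remaining two eigenvalues are the roots of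
  \<open>x\<^sup>2 - s x - t\<close> with \<open>t = 2 a b p\<^sup>2\<close>. One of these is positive and the other negative, and \<open>0\<close> is an
  eigenvalue because there are more than three vertices. So there are exactly three distinct
  eigenvalues if and only if \<open>-s\<close> is a root of the quadratic, that is, \<open>t = 2 s\<^sup>2\<close>. Substituting
  \<open>p\<close> and \<open>q\<close> turns this into \<open>(a + 3b)\<^sup>2 = 16 a b\<close>, which is \<open>(a - b) (a - 9b) = 0\<close>. In that case the
  quadratic is \<open>(x + s) (x - 2s)\<close>, and \<open>a = 9b\<close> gives \<open>s = 5b\<^sup>2\<close>.
\<close>

section \<open>Characteristic polynomials of matrices that are constant on blocks\<close>

lemma char_poly_matrix_four_block:
  assumes "A \<in> carrier_mat n n" "B \<in> carrier_mat n m" "C \<in> carrier_mat m n" "D \<in> carrier_mat m m"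
  shows "char_poly_matrix (four_block_mat A B C D) =
    four_block_mat (char_poly_matrix A) (map_mat (\<lambda>a. [:-a:]) B)
      (map_mat (\<lambda>a. [:-a:]) C) (char_poly_matrix D)"
  using assms by (intro eq_matI) (auto simp: char_poly_matrix_def)

lemma char_poly_zero_mat: "char_poly (0\<^sub>m n n :: 'a :: idom mat) = [:0, 1:] ^ n"
proof -
  have "char_poly (0\<^sub>m n n :: 'a mat) = (\<Prod>a\<leftarrow>diag_mat (0\<^sub>m n n :: 'a mat). [:- a, 1:])"
    by (rule char_poly_upper_triangular[of _ n]) (auto simp: upper_triangular_def)
  also have "diag_mat (0\<^sub>m n n :: 'a mat) = replicate n 0"
    by (intro nth_equalityI) (auto simp: diag_mat_def)
  finally show ?thesis
    by simp
qed

text \<open>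
  Conjugating with \<open>(1, A; 0, 1)\<close> turns the block matrix \<open>(0, 0; B, B A)\<close> into \<open>(A B, 0; B, 0)\<close>.
  These two are block triangular, so their characteristic polynomials are the two sides.
\<close>

lemma char_poly_mult_swap:
  fixes A :: "'a :: idom mat"
  assumes A: "A \<in> carrier_mat n m" and B: "B \<in> carrier_mat m n"
  shows "[:0, 1:] ^ m * char_poly (A * B) = [:0, 1:] ^ n * char_poly (B * A)"
proof -
  define P where "P = four_block_mat (1\<^sub>m n) A (0\<^sub>m m n) (1\<^sub>m m)"
  define Q where "Q = four_block_mat (1\<^sub>m n) (- A) (0\<^sub>m m n) (1\<^sub>m m)"
  define L where "L = four_block_mat (A * B) (0\<^sub>m n m) B (0\<^sub>m m m)"
  define R where "R = four_block_mat (0\<^sub>m n n) (0\<^sub>m n m) B (B * A)"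
  have carr: "{L, R, P, Q} \<subseteq> carrier_mat (n + m) (n + m)"
    using A B by (auto simp: L_def R_def P_def Q_def)
  have nA: "- A \<in> carrier_mat n m"
    using A by simp
  have PQ: "P * Q = 1\<^sub>m (n + m)"
    unfolding P_def Q_def using A nA
    by (subst mult_four_block_mat[of _ n n _ m _ m _ _ n _ m])
       (auto simp: uminus_l_inv_mat intro!: eq_matI)
  have QP: "Q * P = 1\<^sub>m (n + m)"
    unfolding P_def Q_def using A nA
    by (subst mult_four_block_mat[of _ n n _ m _ m _ _ n _ m])
       (auto simp: uminus_l_inv_mat intro!: eq_matI)
  have PR: "P * R = four_block_mat (A * B) (A * (B * A)) B (B * A)"
    unfolding P_def R_def using A B
    by (subst mult_four_block_mat[of _ n n _ m _ m _ _ n _ m]) auto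
  have "L * P = four_block_mat (A * B) (A * (B * A)) B (B * A)"
    unfolding P_def L_def using A B
    by (subst mult_four_block_mat[of _ n n _ m _ m _ _ n _ m]) (auto simp: assoc_mult_mat[of _ n m _ n _ m])
  with PR have "P * R * Q = L * P * Q"
    by simp
  also have "\<dots> = L * (P * Q)"
    using carr by (intro assoc_mult_mat) auto
  also have "\<dots> = L"
    using carr unfolding PQ by auto
  finally have "similar_mat L R"
    using carr PQ QP by (intro similar_matI[of _ _ P Q "n + m"]) auto
  then have "char_poly L = char_poly R"
    by (rule char_poly_similar)
  moreover have "char_poly L = char_poly (A * B) * char_poly (0\<^sub>m m m)"
    unfolding L_def char_poly_def using A B
    by (subst char_poly_matrix_four_block[of _ n _ m])
       (auto intro!: det_four_block_mat_upper_right_zero)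
  moreover have "char_poly R = char_poly (0\<^sub>m n n) * char_poly (B * A)"
    unfolding R_def char_poly_def using A B
    by (subst char_poly_matrix_four_block[of _ n _ m])
       (auto intro!: det_four_block_mat_upper_right_zero)
  ultimately show ?thesis
    by (simp add: char_poly_zero_mat mult.commute)
qed

text \<open>
  The matrix on the right is the quotient by the partition of the indices into the fibres of \<open>c\<close>.
  It arises by moving the incidence matrix of indices and fibres from the left factor to the right.
\<close>

lemma char_poly_constant_on_blocks:
  fixes w :: "nat \<Rightarrow> nat \<Rightarrow> 'a :: idom"
  assumes c: "\<And>i. i < n \<Longrightarrow> c i < k"
  shows "[:0, 1:] ^ k * char_poly (mat n n (\<lambda>(i, j). w (c i) (c j))) =
    [:0, 1:] ^ n * char_poly (mat k k (\<lambda>(s, t). w s t * of_nat (card {i. i < n \<and> c i = t})))"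
proof -
  define P where "P = mat n k (\<lambda>(i, s). of_bool (c i = s) :: 'a)"
  define C where "C = mat k n (\<lambda>(s, j). w s (c j))"
  have "P * C = mat n n (\<lambda>(i, j). w (c i) (c j))"
    using c by (intro eq_matI) (auto simp: P_def C_def scalar_prod_def)
  moreover have "C * P = mat k k (\<lambda>(s, t). w s t * of_nat (card {i. i < n \<and> c i = t}))"
  proof -
    have "(\<Sum>i = 0..<n. w s (c i) * of_bool (c i = t)) = w s t * of_nat (card {i. i < n \<and> c i = t})"
      for s t
    proof -
      have "(\<Sum>i = 0..<n. w s (c i) * of_bool (c i = t)) = (\<Sum>i | i < n \<and> c i = t. w s t)"
        by (rule sum.mono_neutral_cong_right) auto
      then show ?thesis
        by (simp add: mult.commute)
    qed
    then show ?thesis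
      by (intro eq_matI) (auto simp: P_def C_def scalar_prod_def)
  qed
  moreover have "P \<in> carrier_mat n k" "C \<in> carrier_mat k n"
    by (simp_all add: P_def C_def)
  ultimately show ?thesis
    using char_poly_mult_swap[of P n k C] by simp
qed

lemma det_3:
  fixes A :: "'a :: comm_ring_1 mat"
  assumes "A \<in> carrier_mat 3 3"
  shows "det A =
    A $$ (0,0) * (A $$ (1,1) * A $$ (2,2) - A $$ (1,2) * A $$ (2,1))
    - A $$ (0,1) * (A $$ (1,0) * A $$ (2,2) - A $$ (1,2) * A $$ (2,0))
    + A $$ (0,2) * (A $$ (1,0) * A $$ (2,1) - A $$ (1,1) * A $$ (2,0))"
proof -
  have det2: "det B = B $$ (0,0) * B $$ (1,1) - B $$ (0,1) * B $$ (1,0)"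
    if "B \<in> carrier_mat 2 2" for B :: "'a mat"
    using that
    by (subst laplace_expansion_row[of _ 2 0])
       (auto simp: numeral_2_eq_2 cofactor_def det_single mat_delete_def)
  have 3: "{..<3::nat} = {0, 1, 2}"
    by auto
  show ?thesis
    using assms
    by (subst laplace_expansion_row[of _ 3 0])
       (auto simp: 3 cofactor_def mat_delete_def det2 numeral_2_eq_2 algebra_simps)
qed

section \<open>The inverse sum indeg matrix of a complete tripartite graph\<close>

lemma out_degree_conv_arcs_ends:
  assumes "graph G"
  shows "out_degree G v = card {u. (v, u) \<in> arcs_ends G}"
proof -
  interpret graph G by fact
  have "bij_betw (head G) (out_arcs G v) {u. (v, u) \<in> arcs_ends G}"
    using no_multi_arcs
    by (auto simp: bij_betw_def inj_on_def arc_to_ends_def arcs_ends_conv)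
  then show ?thesis
    unfolding out_degree_def by (rule bij_betw_same_card)
qed

lemma complete_tripartite_graph_parts:
  fixes G :: "('v, 'e) pre_digraph"
  assumes G: "complete_tripartite_graph a b c G"
  obtains U V W where "finite U" "finite V" "finite W" "verts G = U \<union> V \<union> W"
    "U \<inter> V = {}" "U \<inter> W = {}" "V \<inter> W = {}" "card U = a" "card V = b" "card W = c"
    "arcs_ends G = U \<times> V \<union> V \<times> U \<union> U \<times> W \<union> W \<times> U \<union> V \<times> W \<union> W \<times> V"
    "\<forall>v\<in>U. out_degree G v = b + c" "\<forall>v\<in>V. out_degree G v = a + c"
    "\<forall>v\<in>W. out_degree G v = a + b"
proof -
  from G obtain U V W where graph: "graph G" and verts: "verts G = U \<union> V \<union> W"
    and disj: "U \<inter> V = {}" "U \<inter> W = {}" "V \<inter> W = {}"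
    and card: "card U = a" "card V = b" "card W = c"
    and ends: "arcs_ends G = U \<times> V \<union> V \<times> U \<union> U \<times> W \<union> W \<times> U \<union> V \<times> W \<union> W \<times> V"
    by (auto simp: complete_tripartite_graph_def)
  interpret graph G by (rule graph)
  have fin: "finite U" "finite V" "finite W"
    using finite_verts by (simp_all add: verts)
  have "{u. (v, u) \<in> arcs_ends G} = V \<union> W" if "v \<in> U" for v
    using that disj by (auto simp: ends)
  moreover have "{u. (v, u) \<in> arcs_ends G} = U \<union> W" if "v \<in> V" for v
    using that disj by (auto simp: ends)
  moreover have "{u. (v, u) \<in> arcs_ends G} = U \<union> V" if "v \<in> W" for v
    using that disj by (auto simp: ends)
  ultimately show thesis
    using that[OF fin verts disj card ends] disj card fin
    by (simp add: out_degree_conv_arcs_ends[OF graph] card_Un_disjoint)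
qed

lemma card_index_distinct:
  assumes "distinct vs" "X \<subseteq> set vs"
  shows "card {i. i < length vs \<and> vs ! i \<in> X} = card X"
proof -
  have "bij_betw (\<lambda>i. vs ! i) {i. i < length vs \<and> vs ! i \<in> X} X"
    using assms by (auto simp: bij_betw_def inj_on_def nth_eq_iff_index_eq in_set_conv_nth subset_iff)
  then show ?thesis
    by (rule bij_betw_same_card)
qed

text \<open>
  The quotient matrix has characteristic polynomial \<open>x\<^sup>3 - (2abp\<^sup>2 + b\<^sup>2q\<^sup>2) x - 2ab\<^sup>2p\<^sup>2q\<close>, and the
  symmetry between the two parts of size \<open>b\<close> makes \<open>x + b q\<close> a factor.
\<close>

lemma char_poly_ISI_complete_tripartite:
  fixes G :: "('v, 'e) pre_digraph" and a b :: nat and p q :: real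
  assumes a: "a \<ge> 1" and b: "b \<ge> 1"
    and G: "complete_tripartite_graph a b b G" and vs: "vertex_enum G vs"
  defines "p \<equiv> isi_weight (real (2 * b)) (real (a + b))"
    and "q \<equiv> isi_weight (real (a + b)) (real (a + b))"
  shows "char_poly (ISI G vs) =
    [:0, 1:] ^ (a + 2 * b - 3) * [:b * q, 1:] * [:- (2 * a * b * p\<^sup>2), - (b * q), 1:]"
proof -
  from G obtain U V W where fin: "finite U" "finite V" "finite W"
    and verts: "verts G = U \<union> V \<union> W"
    and disj: "U \<inter> V = {}" "U \<inter> W = {}" "V \<inter> W = {}"
    and card: "card U = a" "card V = b" "card W = b"
    and ends: "arcs_ends G = U \<times> V \<union> V \<times> U \<union> U \<times> W \<union> W \<times> U \<union> V \<times> W \<union> W \<times> V"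
    and deg: "\<forall>v\<in>U. out_degree G v = b + b" "\<forall>v\<in>V. out_degree G v = a + b"
      "\<forall>v\<in>W. out_degree G v = a + b"
    by (rule complete_tripartite_graph_parts)
  from vs have dist: "distinct vs" and set: "set vs = U \<union> V \<union> W"
    by (auto simp: vertex_enum_def verts)
  define n where "n = length vs"
  have n: "n = a + 2 * b"
    using distinct_card[OF dist] disj fin card
    by (simp add: set n_def card_Un_disjoint Int_Un_distrib2)
  define part where "part v = (if v \<in> U then 0 else if v \<in> V then 1 else 2 :: nat)" for v
  define c where "c i = part (vs ! i)" for i
  define w where "w s t = (if s = t then 0 else if s = 0 \<or> t = 0 then p else q)" for s t :: nat
  have entry: "(if (u, v) \<in> arcs_ends G
      then isi_weight (real (out_degree G u)) (real (out_degree G v)) else 0) = w (part u) (part v)"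
    if "u \<in> U \<union> V \<union> W" "v \<in> U \<union> V \<union> W" for u v
    using that disj
    by (auto simp: ends deg w_def part_def p_def q_def isi_weight_def algebra_simps)
  have ISI: "ISI G vs = mat n n (\<lambda>(i, j). w (c i) (c j))"
    unfolding ISI_def n_def c_def
    using set by (intro eq_matI) (auto simp: entry simp flip: set)
  define Q where "Q = mat 3 3 (\<lambda>(s, t). w s t * of_nat (card {i. i < n \<and> c i = t}))"
  have c0: "card {i. i < n \<and> c i = 0} = a"
  proof -
    have "{i. i < n \<and> c i = 0} = {i. i < length vs \<and> vs ! i \<in> U}"
      by (auto simp: n_def c_def part_def split: if_splits)
    then show ?thesis
      using card_index_distinct[OF dist, of U] by (auto simp: card set)
  qed
  have c1: "card {i. i < n \<and> c i = 1} = b"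
  proof -
    have "{i. i < n \<and> c i = 1} = {i. i < length vs \<and> vs ! i \<in> V}"
      using disj by (auto simp: n_def c_def part_def)
    then show ?thesis
      using card_index_distinct[OF dist, of V] by (auto simp: card set)
  qed
  have c2: "card {i. i < n \<and> c i = 2} = b"
  proof -
    have "{i. i < n \<and> c i = 2} = {i. i < length vs \<and> vs ! i \<in> W}"
      using disj set by (auto simp: n_def c_def part_def dest: nth_mem)
    then show ?thesis
      using card_index_distinct[OF dist, of W] by (auto simp: card set)
  qed
  have "char_poly Q = [:b * q, 1:] * [:- (2 * a * b * p\<^sup>2), - (b * q), 1:]"
    unfolding char_poly_def
    by (subst det_3)
       (simp_all add: char_poly_matrix_def Q_def w_def c0 c1 c2[unfolded numeral_2_eq_2]
          c1[unfolded One_nat_def] c2 algebra_simps power2_eq_square)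
  moreover have "[:0, 1:] ^ 3 * char_poly (ISI G vs) = [:0, 1:] ^ n * char_poly Q"
    unfolding ISI Q_def by (rule char_poly_constant_on_blocks) (simp add: c_def part_def)
  moreover have "[:0, 1:] ^ n = [:0, 1:] ^ 3 * [:0, 1 :: real:] ^ (n - 3)"
    using a b n by (simp flip: power_add)
  \<comment> \<open>Three parts against \<open>n\<close> vertices: \<open>n - 3\<close> factors \<open>x\<close> remain after cancelling.\<close>
  ultimately have "[:0, 1:] ^ 3 * char_poly (ISI G vs) = [:0, 1:] ^ 3 *
      ([:0, 1:] ^ (n - 3) * [:b * q, 1:] * [:- (2 * a * b * p\<^sup>2), - (b * q), 1:])"
    by (simp only: mult.assoc)
  then show ?thesis
    unfolding n by (subst (asm) mult_left_cancel) auto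
qed

section \<open>Coincidences among the eigenvalues\<close>

text \<open>
  The roots \<open>(s \<plusminus> d) / 2\<close> of the quadratic, with \<open>d > s\<close>, have opposite signs. Of the four listed
  numbers only \<open>-s\<close> and the negative root can therefore coincide.
\<close>

lemma card_roots_eq_3_iff:
  fixes s t :: real
  assumes s: "s > 0" and t: "t > 0"
  shows "card {x. x = 0 \<or> x = - s \<or> x\<^sup>2 - s * x - t = 0} = 3 \<longleftrightarrow> t = 2 * s\<^sup>2"
proof -
  define d where "d = sqrt (s\<^sup>2 + 4 * t)"
  have d2: "d\<^sup>2 = s\<^sup>2 + 4 * t"
    using t by (simp add: d_def)
  have "s < d"
    unfolding d_def using t by (intro real_less_rsqrt) simp
  have "x\<^sup>2 - s * x - t = (x - (s + d) / 2) * (x - (s - d) / 2)" for x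
    using d2 by (simp add: field_simps power2_eq_square)
  then have "{x. x = 0 \<or> x = - s \<or> x\<^sup>2 - s * x - t = 0} = {0, - s, (s + d) / 2, (s - d) / 2}"
    by auto
  also have "card \<dots> = 3 \<longleftrightarrow> - s = (s - d) / 2"
    using s \<open>s < d\<close> by (auto simp: card_insert_if)
  also have "\<dots> \<longleftrightarrow> d = 3 * s"
    by (auto simp: field_simps)
  also have "\<dots> \<longleftrightarrow> d\<^sup>2 = (3 * s)\<^sup>2"
    using s \<open>s < d\<close> by (intro power2_eq_iff_nonneg[symmetric]) auto
  also have "\<dots> \<longleftrightarrow> t = 2 * s\<^sup>2"
    unfolding d2 by (auto simp: power_mult_distrib)
  finally show ?thesis .
qed

text \<open>The equation says that the eigenvalue \<open>- b q\<close> is a root of the quadratic factor as well.\<close>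

lemma ISI_double_eigenvalue_iff:
  fixes a b :: nat and p q :: real
  assumes "a \<ge> 1" "b \<ge> 1"
  defines "p \<equiv> isi_weight (real (2 * b)) (real (a + b))"
    and "q \<equiv> isi_weight (real (a + b)) (real (a + b))"
  shows "2 * a * b * p\<^sup>2 = 2 * (b * q)\<^sup>2 \<longleftrightarrow> a = b \<or> a = 9 * b"
proof -
  define x y where "x = real a" and "y = real b"
  have pos: "x > 0" "y > 0"
    using assms by (auto simp: x_def y_def)
  have p: "p = 2 * y * (x + y) / (x + 3 * y)"
    by (simp add: p_def isi_weight_def x_def y_def algebra_simps)
  have q: "q = (x + y) / 2"
    using pos by (simp add: q_def isi_weight_def x_def y_def field_simps)
  have "2 * x * y * p\<^sup>2 - 2 * (y * q)\<^sup>2 =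
      y\<^sup>2 * (x + y)\<^sup>2 / (2 * (x + 3 * y)\<^sup>2) * (16 * x * y - (x + 3 * y)\<^sup>2)"
    using pos unfolding p q by (simp add: divide_simps) (simp add: algebra_simps power2_eq_square)
  also have "16 * x * y - (x + 3 * y)\<^sup>2 = - ((x - y) * (x - 9 * y))"
    by (simp add: algebra_simps power2_eq_square)
  finally have eq: "2 * x * y * p\<^sup>2 - 2 * (y * q)\<^sup>2 =
      y\<^sup>2 * (x + y)\<^sup>2 / (2 * (x + 3 * y)\<^sup>2) * - ((x - y) * (x - 9 * y))" .
  have "y\<^sup>2 * (x + y)\<^sup>2 / (2 * (x + 3 * y)\<^sup>2) \<noteq> 0"
    using pos by simp
  then have "2 * x * y * p\<^sup>2 - 2 * (y * q)\<^sup>2 = 0 \<longleftrightarrow> (x - y) * (x - 9 * y) = 0"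
    unfolding eq mult_eq_0_iff[of _ "- _"] by simp
  then have "2 * x * y * p\<^sup>2 = 2 * (y * q)\<^sup>2 \<longleftrightarrow> x = y \<or> x = 9 * y"
    by simp
  also have "\<dots> \<longleftrightarrow> a = b \<or> a = 9 * b"
    by (auto simp: x_def y_def)
  finally show ?thesis
    by (simp add: x_def y_def)
qed

lemma card_spectrum_ISI_complete_tripartite:
  fixes G :: "('v, 'e) pre_digraph" and a b :: nat
  assumes ab: "a \<ge> 1" "b \<ge> 1" and n: "a + 2 * b > 3"
    and G: "complete_tripartite_graph a b b G" "vertex_enum G vs"
  shows "card (spectrum (ISI G vs)) = 3 \<longleftrightarrow> a = b \<or> a = 9 * b"
proof -
  define p where "p = isi_weight (real (2 * b)) (real (a + b))"
  define q where "q = isi_weight (real (a + b)) (real (a + b))"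
  have "p > 0" "q > 0"
    using ab by (auto simp: p_def q_def isi_weight_def intro!: divide_pos_pos mult_pos_pos add_pos_pos)
  have "spectrum (ISI G vs) = {x. poly (char_poly (ISI G vs)) x = 0}"
    by (rule spectrum_root_char_poly[of _ "length vs"]) (simp add: ISI_def)
  also have "\<dots> = {x. x = 0 \<or> x = - (b * q) \<or> x\<^sup>2 - b * q * x - 2 * a * b * p\<^sup>2 = 0}"
  proof -
    have "poly (char_poly (ISI G vs)) x =
        x ^ (a + 2 * b - 3) * (x + b * q) * (x\<^sup>2 - b * q * x - 2 * a * b * p\<^sup>2)" for x
      unfolding char_poly_ISI_complete_tripartite[OF ab G] p_def[symmetric] q_def[symmetric]
        poly_mult poly_power
      by (simp add: algebra_simps power2_eq_square)
    then show ?thesis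
      using n by (simp add: add_eq_0_iff2)
  qed
  also have "card \<dots> = 3 \<longleftrightarrow> 2 * a * b * p\<^sup>2 = 2 * (b * q)\<^sup>2"
    using ab \<open>p > 0\<close> \<open>q > 0\<close> by (intro card_roots_eq_3_iff) auto
  also have "\<dots> \<longleftrightarrow> a = b \<or> a = 9 * b"
    unfolding p_def q_def by (rule ISI_double_eigenvalue_iff[OF ab])
  finally show ?thesis .
qed

lemma Spec_ISI_9b_b_b:
  fixes G :: "('v, 'e) pre_digraph" and b :: nat
  assumes b: "b \<ge> 1" and G: "complete_tripartite_graph (9 * b) b b G" "vertex_enum G vs"
  shows "Spec (ISI G vs) =
    replicate_mset (11 * b - 3) 0 + {#10 * (real b)\<^sup>2#} + replicate_mset 2 (- 5 * (real b)\<^sup>2)"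
proof -
  define p where "p = isi_weight (real (2 * b)) (real (9 * b + b))"
  define q where "q = isi_weight (real (9 * b + b)) (real (9 * b + b))"
  define s where "s = 5 * (real b)\<^sup>2"
  have bq: "b * q = s"
    using b by (simp add: q_def s_def isi_weight_def power2_eq_square)
  have "2 * (9 * b) * b * p\<^sup>2 = 2 * (b * q)\<^sup>2"
    using ISI_double_eigenvalue_iff[of "9 * b" b] b by (simp add: p_def q_def)
  then have t: "2 * (9 * b) * b * p\<^sup>2 = 2 * s\<^sup>2"
    by (simp only: bq)
  have "char_poly (ISI G vs) =
      [:0, 1:] ^ (11 * b - 3) * [:s, 1:] * [:- (2 * s\<^sup>2), - s, 1:]"
    using char_poly_ISI_complete_tripartite[OF _ b G] b
    unfolding p_def[symmetric] q_def[symmetric] bq t by simp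
  also have "[:- (2 * s\<^sup>2), - s, 1:] = [:s, 1:] * [:- (2 * s), 1:]"
    by (simp add: power2_eq_square)
  finally have "Spec (ISI G vs) =
      proots ([:0, 1:] ^ (11 * b - 3) * [:s, 1:] * ([:s, 1:] * [:- (2 * s), 1:]))"
    by (simp only: Spec_def)
  also have "\<dots> = repeat_mset (11 * b - 3) {#0#} + {#- s#} + ({#- s#} + {#2 * s#})"
    by (simp add: proots_mult proots_power del: mult_pCons_left mult_pCons_right)
  finally show ?thesis
    by (simp add: s_def numeral_2_eq_2)
qed

lemma complete_tripartite_9b_b_b_not_regular:
  fixes G :: "('v, 'e) pre_digraph" and b :: nat
  assumes b: "b \<ge> 1" and G: "complete_tripartite_graph (9 * b) b b G"
  shows "\<not> regular_graph G"
proof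
  assume "regular_graph G"
  then obtain k where k: "\<And>v. v \<in> verts G \<Longrightarrow> out_degree G v = k"
    by (auto simp: regular_graph_def)
  from G obtain U V W where "verts G = U \<union> V \<union> W" "card U = 9 * b" "card V = b"
    and deg: "\<forall>v\<in>U. out_degree G v = b + b" "\<forall>v\<in>V. out_degree G v = 9 * b + b"
    by (rule complete_tripartite_graph_parts)
  moreover have "U \<noteq> {}" "V \<noteq> {}"
    using b \<open>card U = 9 * b\<close> \<open>card V = b\<close> by auto
  ultimately have "b + b = k" "9 * b + b = k"
    using k by fastforce+
  with b show False
    by simp
qed

theorem proposition2p9:
  shows "(\<forall>(a::nat) (b::nat) (G :: ('v, 'e) pre_digraph) vs.
            a \<ge> 1 \<longrightarrow> b \<ge> 1 \<longrightarrow> a + 2 * b > 3 \<longrightarrow>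
            complete_tripartite_graph a b b G \<longrightarrow> vertex_enum G vs \<longrightarrow>
            (card (spectrum (ISI G vs)) = 3 \<longleftrightarrow> a = b \<or> a = 9 * b))
       \<and> (\<forall>(b::nat) (G :: ('v, 'e) pre_digraph) vs.
            b \<ge> 1 \<longrightarrow> complete_tripartite_graph (9 * b) b b G \<longrightarrow> vertex_enum G vs \<longrightarrow>
            \<not> regular_graph G \<and>
            Spec (ISI G vs) =
              replicate_mset (11 * b - 3) 0 + {#10 * (real b)\<^sup>2#}
              + replicate_mset 2 (- 5 * (real b)\<^sup>2))"
  using card_spectrum_ISI_complete_tripartite complete_tripartite_9b_b_b_not_regular
    Spec_ISI_9b_b_b by blast

end
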